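(* Let $(G,X,\sigma)$ be a loosely faithful self-similar group action over a finite set $X$ with faithful quotient $(\overline G,X,\sigma)$. Then the (topological) groupoids $\mathscr G_{(G,X)}$ and $\mathscr G_{(\overline G,X)}$ are isomorphic. Moreover, a contracting self-similar group action $(G,X,\sigma)$ is loosely faithful if every nontrivial element of its nucleus acts nontrivially on the set of finite words over $X$.
   Context: Self-similar group action $(G,X,\sigma)$: a discrete group $G$, a finite set $X$ with $|X|\ge2$, a left action $(g,x)\mapsto g(x)$ of $G$ on $X$, and a map $\sigma\colon G\times X\to G$, written $g|_x=\sigma(g,x)$, with $(hg)|_x=h|_{g(x)}g|_x$. These extend to finite words by $g(\emptyset)=\emptyset$, $g|_\emptyset=g$, $g(xw)=g(x)g|_x(w)$, $g|_{xw}=(g|_x)|_w$, and the action extends to $X^{\mathbb N}$. Kernel: $N=\{g\in G: g(w)=w\text{ for all finite words }w\}$. The faithful quotient is $\overline G=G/N$ with $(gN)(x)=g(x)$, $(gN)|_x=g|_xN$. Tight kernel: $K=\bigcup_{n\ge0}K_n$ where $K_n=\{g\in G: g(w)=w\text{ and }g|_w=1\text{ for all }w\in X^n\}$; one has $K\subseteq N$. The action is loosely faithful if $K=N$. Contracting: there is a finite $F\subseteq G$ such that for every $g\in G$ there is $n\ge0$ with $g|_w\in F$ for all words $w$ of length at least $n$. The nucleus is the unique smallest such $F$. Groupoid $\mathscr G_{(G,X)}$: let $S_{(G,X)}$ be the inverse semigroup consisting of $0$ and all triples $(p,g,q)$ with $p,q$ finite words and $g\in G$, with product $(p,g,q)(p',h,q')=(p\,g(r),g|_r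 h,q')$ if $p'=qr$, $=(p,g\,h|_{h^{-1}(s)},q'h^{-1}(s))$ if $q=p's$, and $0$ otherwise. It acts on $X^{\mathbb N}$ by $(p,g,q)\colon qX^{\mathbb N}\to pX^{\mathbb N}$, $qw\mapsto p\,g(w)$. $\mathscr G_{(G,X)}$ is the groupoid of classes $[s,w]$, $w\in\mathrm{dom}(s)$, where $[s,w]=[t,w']$ iff $w=w'$ and $se=te$ for some idempotent $e=(u,1,u)$ with $w\in uX^{\mathbb N}$; $[s,t(w)][t,w]=[st,w]$; basic open sets $\{[s,w]:w\in U\}$ with $U\subseteq\mathrm{dom}(s)$ open. *)

theory Defs
  imports
    "HOL-Algebra.Group_Action"
    "HOL-Analysis.Function_Topology"
    "HOL-Library.Omega_Words_Fun"
begin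

section \<open>Topological groupoids\<close>

text \<open>
  A groupoid is given by its arrows only, each object being identified with the unit arrow at it.
  The arrow set is the underlying set of the topology \<open>arrows\<close>, and
  \<open>comp a b\<close> is meaningful when \<open>src a = rng b\<close>. Inversion is determined by these data.
\<close>

record 'a top_groupoid =
  arrows :: "'a topology"
  src :: "'a \<Rightarrow> 'a"
  rng :: "'a \<Rightarrow> 'a"
  comp :: "'a \<Rightarrow> 'a \<Rightarrow> 'a"

definition top_groupoid_iso :: "'a top_groupoid \<Rightarrow> 'b top_groupoid \<Rightarrow> ('a \<Rightarrow> 'b) \<Rightarrow> bool" where
  "top_groupoid_iso \<G> \<H> f \<longleftrightarrow>
     homeomorphic_map (arrows \<G>) (arrows \<H>) f \<and>
     (\<forall>a\<in>topspace (arrows \<G>). f (src \<G> a) = src \<H> (f a) \<and> f (rng \<G> a) = rng \<H> (f a)) \<and>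
     (\<forall>a\<in>topspace (arrows \<G>). \<forall>b\<in>topspace (arrows \<G>).
        src \<G> a = rng \<G> b \<longrightarrow> f (comp \<G> a b) = comp \<H> (f a) (f b))"

definition isomorphic_top_groupoids :: "'a top_groupoid \<Rightarrow> 'b top_groupoid \<Rightarrow> bool" where
  "isomorphic_top_groupoids \<G> \<H> \<longleftrightarrow> (\<exists>f. top_groupoid_iso \<G> \<H> f)"


section \<open>Self-similar actions\<close>

datatype ('x, 'g) triple = Zero | Triple "'x list" 'g "'x list"

text \<open>
  This locale has no assumptions, so that every definition made in it applies unconditionally, both
  to an action and to its faithful quotient. We write \<open>res g x\<close> for $g|_x$. Finite words over
  \<open>X\<close> are the elements of \<open>lists X\<close>.
\<close>

locale self_similar_data =
  fixes G :: "('g, 'm) monoid_scheme" (structure)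
    and X :: "'x set"
    and act :: "'g \<Rightarrow> 'x \<Rightarrow> 'x"
    and res :: "'g \<Rightarrow> 'x \<Rightarrow> 'g"
begin

primrec res_word :: "'g \<Rightarrow> 'x list \<Rightarrow> 'g" where
  "res_word g [] = g"
| "res_word g (x # w) = res_word (res g x) w"

primrec act_word :: "'g \<Rightarrow> 'x list \<Rightarrow> 'x list" where
  "act_word g [] = []"
| "act_word g (x # w) = act g x # act_word (res g x) w"

definition act_kernel :: "'g set" where
  "act_kernel = {g \<in> carrier G. \<forall>w\<in>lists X. act_word g w = w}"

definition tight_kernel_level :: "nat \<Rightarrow> 'g set" where
  "tight_kernel_level n =
     {g \<in> carrier G. \<forall>w\<in>lists X. length w = n \<longrightarrow> act_word g w = w \<and> res_word g w = \<one>}"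

definition tight_kernel :: "'g set" where
  "tight_kernel = (\<Union>n. tight_kernel_level n)"

definition loosely_faithful :: bool where
  "loosely_faithful \<longleftrightarrow> tight_kernel = act_kernel"


subsection \<open>The faithful quotient\<close>

text \<open>
  The quotient group is \<open>G Mod act_kernel\<close>. The elements of a coset of the kernel share one value
  of \<open>act\<close> and one coset of \<open>res _ x\<close>, extracted by \<^const>\<open>the_elem\<close>.
\<close>

definition quot_act :: "'g set \<Rightarrow> 'x \<Rightarrow> 'x" where
  "quot_act A x = the_elem ((\<lambda>g. act g x) ` A)"

definition quot_res :: "'g set \<Rightarrow> 'x \<Rightarrow> 'g set" where
  "quot_res A x = the_elem ((\<lambda>g. act_kernel #> res g x) ` A)"


subsection \<open>Contracting actions\<close>

definition contracting_set :: "'g set \<Rightarrow> bool" where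
  "contracting_set F \<longleftrightarrow> finite F \<and> F \<subseteq> carrier G \<and>
     (\<forall>g\<in>carrier G. \<exists>n. \<forall>w\<in>lists X. length w \<ge> n \<longrightarrow> res_word g w \<in> F)"

definition contracting :: bool where
  "contracting \<longleftrightarrow> (\<exists>F. contracting_set F)"

text \<open>The order used by \<open>LEAST\<close> is inclusion.\<close>

definition nucleus :: "'g set" where
  "nucleus = (LEAST F. contracting_set F)"


subsection \<open>The inverse semigroup and its action on infinite words\<close>

definition S :: "('x, 'g) triple set" where
  "S = insert Zero {Triple p g q | p g q. p \<in> lists X \<and> g \<in> carrier G \<and> q \<in> lists X}"

fun S_mult :: "('x, 'g) triple \<Rightarrow> ('x, 'g) triple \<Rightarrow> ('x, 'g) triple" where
  "S_mult (Triple p g q) (Triple p' h q') =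
     (if \<exists>r. p' = q @ r then
        let r = drop (length q) p'
        in Triple (p @ act_word g r) (res_word g r \<otimes> h) q'
      else if \<exists>s. q = p' @ s then
        let s = drop (length p') q; s' = act_word (inv h) s
        in Triple p (g \<otimes> res_word h s') (q' @ s')
      else Zero)"
| "S_mult Zero _ = Zero"
| "S_mult _ Zero = Zero"

definition inf_words :: "'x word topology" where
  "inf_words = product_topology (\<lambda>_. discrete_topology X) UNIV"

definition cylinder :: "'x list \<Rightarrow> 'x word set" where
  "cylinder u = {u \<frown> w | w. w \<in> topspace inf_words}"

definition act_inf :: "'g \<Rightarrow> 'x word \<Rightarrow> 'x word" where
  "act_inf g w = (\<lambda>n. act_word g (prefix (Suc n) w) ! n)"

fun S_dom :: "('x, 'g) triple \<Rightarrow> 'x word set" where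
  "S_dom Zero = {}"
| "S_dom (Triple p g q) = cylinder q"

text \<open>\<open>S_app s\<close> is relevant on \<open>S_dom s\<close> only.\<close>

fun S_app :: "('x, 'g) triple \<Rightarrow> 'x word \<Rightarrow> 'x word" where
  "S_app Zero w = w"
| "S_app (Triple p g q) w = p \<frown> act_inf g (suffix (length q) w)"


subsection \<open>The groupoid of germs\<close>

definition germ_pairs :: "(('x, 'g) triple \<times> 'x word) set" where
  "germ_pairs = {(s, w). s \<in> S \<and> w \<in> S_dom s}"

definition germ_rel :: "((('x, 'g) triple \<times> 'x word) \<times> (('x, 'g) triple \<times> 'x word)) set" where
  "germ_rel = {((s, w), (t, w')). (s, w) \<in> germ_pairs \<and> (t, w') \<in> germ_pairs \<and> w = w' \<and>
     (\<exists>u\<in>lists X. w \<in> cylinder u \<and> S_mult s (Triple u \<one> u) = S_mult t (Triple u \<one> u))}"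

definition germ :: "('x, 'g) triple \<Rightarrow> 'x word \<Rightarrow> (('x, 'g) triple \<times> 'x word) set" where
  "germ s w = germ_rel `` {(s, w)}"

definition germ_topology :: "(('x, 'g) triple \<times> 'x word) set topology" where
  "germ_topology =
     topology_generated_by {germ s ` U | s U. s \<in> S \<and> openin inf_words U \<and> U \<subseteq> S_dom s}"

definition unit_germ :: "'x word \<Rightarrow> (('x, 'g) triple \<times> 'x word) set" where
  "unit_germ w = germ (Triple [] \<one> []) w"

definition germ_src ::
    "(('x, 'g) triple \<times> 'x word) set \<Rightarrow> (('x, 'g) triple \<times> 'x word) set" where
  "germ_src a = (THE c. \<exists>(s, w)\<in>germ_pairs. a = germ s w \<and> c = unit_germ w)"

definition germ_rng ::
    "(('x, 'g) triple \<times> 'x word) set \<Rightarrow> (('x, 'g) triple \<times> 'x word) set" where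
  "germ_rng a = (THE c. \<exists>(s, w)\<in>germ_pairs. a = germ s w \<and> c = unit_germ (S_app s w))"

definition germ_comp ::
    "(('x, 'g) triple \<times> 'x word) set \<Rightarrow> (('x, 'g) triple \<times> 'x word) set \<Rightarrow>
      (('x, 'g) triple \<times> 'x word) set" where
  "germ_comp a b = (THE c. \<exists>s t w. (s, S_app t w) \<in> germ_pairs \<and> (t, w) \<in> germ_pairs \<and>
     a = germ s (S_app t w) \<and> b = germ t w \<and> c = germ (S_mult s t) w)"

definition germ_groupoid :: "(('x, 'g) triple \<times> 'x word) set top_groupoid" where
  "germ_groupoid =
     \<lparr>arrows = germ_topology, src = germ_src, rng = germ_rng, comp = germ_comp\<rparr>"

end

text \<open>\<open>group_action\<close> makes each \<open>act g\<close> undefined outside \<open>X\<close>.\<close>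

locale self_similar_action =
  self_similar_data G X act res + group_action G X act
  for G :: "('g, 'm) monoid_scheme" (structure)
    and X :: "'x set"
    and act :: "'g \<Rightarrow> 'x \<Rightarrow> 'x"
    and res :: "'g \<Rightarrow> 'x \<Rightarrow> 'g" +
  assumes finite_alphabet: "finite X"
    and card_alphabet: "card X \<ge> 2"
    and res_closed: "\<lbrakk>g \<in> carrier G; x \<in> X\<rbrakk> \<Longrightarrow> res g x \<in> carrier G"
    and res_mult: "\<lbrakk>h \<in> carrier G; g \<in> carrier G; x \<in> X\<rbrakk> \<Longrightarrow>
      res (h \<otimes> g) x = res h (act g x) \<otimes> res g x"

end

theory Submission
  imports Defs
begin

text \<open>
  Two triples have the same germ at \<open>w\<close> iff their products with \<open>(u, 1, u)\<close> agree for all long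
  prefixes \<open>u\<close> of \<open>w\<close>. If this holds modulo the kernel \<open>N\<close>, say \<open>(p, g, u)\<close> and \<open>(p, h, u)\<close> with
  \<open>g h\<inverse> \<in> N\<close>, and \<open>N\<close> is the tight kernel, then \<open>g h\<inverse> \<in> K\<^sub>n\<close> for some \<open>n\<close>, so that the two
  products coincide after prolonging \<open>u\<close> by \<open>n\<close> letters. Hence \<open>(p, g, q) \<mapsto> (p, g N, q)\<close> induces a
  bijection on germs, which carries the basic open sets of one groupoid onto those of the other.

  If the action is contracting and \<open>g \<in> N\<close>, then all restrictions of \<open>g\<close> to long words lie in
  the nucleus and in \<open>N\<close>; when only \<open>1\<close> lies in both, this says \<open>g \<in> K\<^sub>n\<close>.
\<close>

section \<open>Words and self-similarity\<close>

context self_similar_data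
begin

lemma length_act_word [simp]: "length (act_word g w) = length w"
  by (induction w arbitrary: g) auto

lemma act_word_append: "act_word g (v @ w) = act_word g v @ act_word (res_word g v) w"
  by (induction v arbitrary: g) auto

lemma res_word_append: "res_word g (v @ w) = res_word (res_word g v) w"
  by (induction v arbitrary: g) auto

end

context self_similar_action
begin

sublocale group G
  using group_hom group_hom.axioms(1) by auto

lemma act_closed: "\<lbrakk>g \<in> carrier G; x \<in> X\<rbrakk> \<Longrightarrow> act g x \<in> X"
  using element_image by blast

lemma act_one: "x \<in> X \<Longrightarrow> act \<one> x = x"
  by (metis id_eq_one restrict_apply')

text \<open>The cocycle identity with both factors equal to \<open>\<one>\<close> makes this
  restriction idempotent, and a group has only one idempotent.\<close>

lemma res_one: "x \<in> X \<Longrightarrow> res \<one> x = \<one>"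
  using res_mult[of \<one> \<one> x] by (simp add: act_one res_closed)

lemma res_word_closed: "\<lbrakk>g \<in> carrier G; w \<in> lists X\<rbrakk> \<Longrightarrow> res_word g w \<in> carrier G"
  by (induction w arbitrary: g) (auto simp: res_closed)

lemma act_word_closed: "\<lbrakk>g \<in> carrier G; w \<in> lists X\<rbrakk> \<Longrightarrow> act_word g w \<in> lists X"
  by (induction w arbitrary: g) (auto simp: res_closed act_closed)

lemma act_word_one: "w \<in> lists X \<Longrightarrow> act_word \<one> w = w"
  by (induction w) (auto simp: act_one res_one)

lemma res_word_one: "w \<in> lists X \<Longrightarrow> res_word \<one> w = \<one>"
  by (induction w) (auto simp: act_one res_one)

lemma act_word_mult:
  "\<lbrakk>h \<in> carrier G; g \<in> carrier G; w \<in> lists X\<rbrakk> \<Longrightarrow> act_word (h \<otimes> g) w = act_word h (act_word g w)"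
  by (induction w arbitrary: g h) (auto simp: composition_rule res_mult res_closed act_closed)

lemma res_word_mult:
  "\<lbrakk>h \<in> carrier G; g \<in> carrier G; w \<in> lists X\<rbrakk> \<Longrightarrow>
    res_word (h \<otimes> g) w = res_word h (act_word g w) \<otimes> res_word g w"
  by (induction w arbitrary: g h) (auto simp: composition_rule res_mult res_closed act_closed)

lemma act_word_inv:
  "\<lbrakk>g \<in> carrier G; w \<in> lists X\<rbrakk> \<Longrightarrow> act_word (inv g) (act_word g w) = w"
  using act_word_mult[of "inv g" g w] by (simp add: act_word_one)

lemma act_word_inv':
  "\<lbrakk>g \<in> carrier G; w \<in> lists X\<rbrakk> \<Longrightarrow> act_word g (act_word (inv g) w) = w"
  using act_word_mult[of g "inv g" w] by (simp add: act_word_one)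

text \<open>An element that fixes both \<open>v\<close> and \<open>v @ w\<close> must have a
  restriction at \<open>v\<close> that fixes \<open>w\<close>.\<close>

lemma act_kernel_res_word:
  assumes "g \<in> act_kernel" "v \<in> lists X"
  shows "res_word g v \<in> act_kernel"
proof -
  have "act_word (res_word g v) w = w" if "w \<in> lists X" for w
  proof -
    have "act_word g (v @ w) = v @ w" "act_word g v = v"
      using assms that by (auto simp: act_kernel_def)
    then show ?thesis by (simp add: act_word_append)
  qed
  then show ?thesis using assms by (auto simp: act_kernel_def res_word_closed)
qed

lemma subgroup_act_kernel: "subgroup act_kernel G"
proof (rule subgroupI)
  show "act_kernel \<subseteq> carrier G" by (auto simp: act_kernel_def)
  show "act_kernel \<noteq> {}" using act_word_one by (auto simp: act_kernel_def)
next
  fix a assume a: "a \<in> act_kernel"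
  then have "act_word (inv a) w = w" if "w \<in> lists X" for w
    using act_word_inv[of a w] that by (simp add: act_kernel_def)
  with a show "inv a \<in> act_kernel" by (auto simp: act_kernel_def)
next
  fix a b assume "a \<in> act_kernel" "b \<in> act_kernel"
  then show "a \<otimes> b \<in> act_kernel" by (auto simp: act_kernel_def act_word_mult)
qed

lemma normal_act_kernel: "act_kernel \<lhd> G"
  unfolding normal_inv_iff
  by (auto simp: subgroup_act_kernel)
    (auto simp: act_kernel_def act_word_mult act_word_closed act_word_inv')

lemma act_kernel_subset: "act_kernel \<subseteq> carrier G"
  using subgroup_act_kernel by (rule subgroup.subset)


section \<open>Contracting actions\<close>

lemma contracting_set_Int:
  assumes "contracting_set A" "contracting_set B"
  shows "contracting_set (A \<inter> B)"
  unfolding contracting_set_def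
proof (intro conjI ballI)
  show "finite (A \<inter> B)" "A \<inter> B \<subseteq> carrier G" using assms by (auto simp: contracting_set_def)
next
  fix g assume "g \<in> carrier G"
  then obtain m n where "\<forall>w\<in>lists X. length w \<ge> m \<longrightarrow> res_word g w \<in> A"
      "\<forall>w\<in>lists X. length w \<ge> n \<longrightarrow> res_word g w \<in> B"
    using assms unfolding contracting_set_def by meson
  then show "\<exists>n. \<forall>w\<in>lists X. length w \<ge> n \<longrightarrow> res_word g w \<in> A \<inter> B"
    by (intro exI[of _ "max m n"]) auto
qed

text \<open>Contracting sets are closed under intersection, so one of least cardinality is the least.\<close>

lemma contracting_set_nucleus:
  assumes contracting
  shows "contracting_set nucleus"
proof -
  obtain F where F: "contracting_set F" and min: "\<And>F'. contracting_set F' \<Longrightarrow> card F \<le> card F'"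
    using assms unfolding contracting_def
    by (metis ex_has_least_nat)
  have "F \<subseteq> F'" if "contracting_set F'" for F'
  proof -
    have "card F \<le> card (F \<inter> F')" using F that by (intro min contracting_set_Int)
    then have "F \<inter> F' = F" using F by (intro card_seteq) (auto simp: contracting_set_def)
    then show ?thesis by blast
  qed
  then have "nucleus = F" unfolding nucleus_def using F by (intro Least_equality) auto
  with F show ?thesis by simp
qed

lemma tight_kernel_subset_act_kernel: "tight_kernel \<subseteq> act_kernel"
proof
  fix g assume "g \<in> tight_kernel"
  then obtain n where g: "g \<in> carrier G"
    and n: "\<And>w. \<lbrakk>w \<in> lists X; length w = n\<rbrakk> \<Longrightarrow> act_word g w = w \<and> res_word g w = \<one>"
    by (auto simp: tight_kernel_def tight_kernel_level_def)
  obtain x where x: "x \<in> X" using card_alphabet by fastforce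
  have "act_word g w = w" if w: "w \<in> lists X" for w
  proof -
    \<comment> \<open>Padding makes the length at least \<open>n\<close> even for short
      \<open>w\<close>: the first \<open>n\<close> letters are fixed and the remaining ones are
      acted on by \<open>\<one>\<close>. Fixing \<open>v\<close> then includes fixing its initial
      part \<open>w\<close>.\<close>
    define v where "v = w @ replicate n x"
    have v: "v \<in> lists X" using w x by (auto simp: v_def)
    have take: "take n v \<in> lists X" "length (take n v) = n"
      using v by (auto dest: in_set_takeD) (simp add: v_def)
    have "drop n v \<in> lists X" using v by (auto dest: in_set_dropD)
    then have "act_word g v = v"
      using n[OF take] act_word_append[of g "take n v" "drop n v"] by (simp add: act_word_one)
    then show ?thesis by (simp add: v_def act_word_append)
  qed
  with g show "g \<in> act_kernel" by (simp add: act_kernel_def)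
qed

lemma contracting_imp_loosely_faithful:
  assumes contracting
    and nontrivial: "\<And>g. \<lbrakk>g \<in> nucleus; g \<noteq> \<one>\<rbrakk> \<Longrightarrow> \<exists>w\<in>lists X. act_word g w \<noteq> w"
  shows loosely_faithful
proof -
  have "g \<in> tight_kernel" if g: "g \<in> act_kernel" for g
  proof -
    have "g \<in> carrier G" using g by (simp add: act_kernel_def)
    then obtain n where n: "\<And>w. \<lbrakk>w \<in> lists X; length w \<ge> n\<rbrakk> \<Longrightarrow> res_word g w \<in> nucleus"
      using contracting_set_nucleus[OF \<open>contracting\<close>] unfolding contracting_set_def by blast
    have "res_word g w = \<one>" if "w \<in> lists X" "length w = n" for w
      using nontrivial[OF n] act_kernel_res_word[OF g] that by (force simp: act_kernel_def)
    then have "g \<in> tight_kernel_level n"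
      using g by (auto simp: tight_kernel_level_def act_kernel_def)
    then show ?thesis by (auto simp: tight_kernel_def)
  qed
  then show ?thesis using tight_kernel_subset_act_kernel by (auto simp: loosely_faithful_def)
qed


section \<open>The faithful quotient\<close>

abbreviation "coset g \<equiv> act_kernel #> g"
abbreviation "quot \<equiv> G Mod act_kernel"

lemma coset_eq_iff:
  assumes "g \<in> carrier G" "h \<in> carrier G"
  shows "coset g = coset h \<longleftrightarrow> g \<otimes> inv h \<in> act_kernel"
proof -
  have "g \<in> coset h \<longleftrightarrow> g \<otimes> inv h \<in> act_kernel"
    using assms act_kernel_subset
    by (auto simp: r_coset_def m_assoc intro!: bexI[of _ "g \<otimes> inv h"])
  then show ?thesis
    using assms subgroup_act_kernel repr_independence rcos_self by metis
qed

lemma coset_obtain: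
  assumes "k \<in> coset g" "g \<in> carrier G"
  obtains n where "n \<in> act_kernel" "k = n \<otimes> g"
  using assms by (auto simp: r_coset_def)

lemma coset_nonempty: "g \<in> carrier G \<Longrightarrow> coset g \<noteq> {}"
  using rcos_self subgroup_act_kernel by blast

lemma act_kernel_act: "\<lbrakk>n \<in> act_kernel; x \<in> X\<rbrakk> \<Longrightarrow> act n x = x"
  unfolding act_kernel_def by (auto dest: bspec[of _ _ "[x]"])

lemma act_kernel_res: "\<lbrakk>n \<in> act_kernel; x \<in> X\<rbrakk> \<Longrightarrow> res n x \<in> act_kernel"
  using act_kernel_res_word[of n "[x]"] by auto

text \<open>Every representative is \<open>n \<otimes> g\<close> with \<open>n\<close> in the
  kernel, and \<open>n\<close> fixes the letter \<open>act g x\<close>; so \<open>the_elem\<close>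
  is applied to a singleton.\<close>

lemma quot_act_coset:
  assumes g: "g \<in> carrier G" and x: "x \<in> X"
  shows "quot_act (coset g) x = act g x"
proof -
  have "act k x = act g x" if "k \<in> coset g" for k
    using that g x act_kernel_subset
    by (auto elim!: coset_obtain simp: composition_rule act_kernel_act act_closed subsetD)
  then have "(\<lambda>k. act k x) ` coset g = {act g x}"
    using coset_nonempty[OF g] by auto
  then show ?thesis by (simp add: quot_act_def)
qed

text \<open>By the cocycle identity \<open>n \<otimes> g\<close> restricts at \<open>x\<close> to
  \<open>res n (act g x) \<otimes> res g x\<close>, and the left factor stays in the kernel when
  \<open>n\<close> lies there.\<close>

lemma quot_res_coset:
  assumes g: "g \<in> carrier G" and x: "x \<in> X"
  shows "quot_res (coset g) x = coset (res g x)"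
proof -
  have "coset (res k x) = coset (res g x)" if k: "k \<in> coset g" for k
  proof -
    obtain n where n: "n \<in> act_kernel" "k = n \<otimes> g" using k g by (rule coset_obtain)
    define m where "m = res n (act g x)"
    have m: "m \<in> act_kernel" unfolding m_def using n g x by (intro act_kernel_res act_closed)
    have "res k x = m \<otimes> res g x"
      using n g x act_kernel_subset by (auto simp: res_mult m_def)
    moreover have "m \<in> carrier G" "res g x \<in> carrier G"
      using m act_kernel_subset g x res_closed by auto
    ultimately show ?thesis using m by (simp add: coset_eq_iff m_assoc)
  qed
  then have "(\<lambda>k. coset (res k x)) ` coset g = {coset (res g x)}"
    using coset_nonempty[OF g] by auto
  then show ?thesis by (simp add: quot_res_def)
qed

lemma quot_act_outside: "\<lbrakk>g \<in> carrier G; x \<notin> X\<rbrakk> \<Longrightarrow> quot_act (coset g) x = undefined"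
proof -
  assume g: "g \<in> carrier G" and x: "x \<notin> X"
  have "act k x = undefined" if "k \<in> coset g" for k
  proof -
    have "k \<in> carrier G" using that g act_kernel_subset r_coset_subset_G by blast
    then show ?thesis using bij_prop0 x by (auto simp: Bij_def extensional_def)
  qed
  then have "(\<lambda>k. act k x) ` coset g = {undefined}"
    using coset_nonempty[OF g] by auto
  then show ?thesis by (simp add: quot_act_def)
qed

text \<open>\<open>BijGroup X\<close> consists of functions that are \<open>undefined\<close> off
  \<open>X\<close>, so the comparison has to be made on the whole type and not only on
  letters.\<close>

lemma quot_act_coset_eq: "g \<in> carrier G \<Longrightarrow> quot_act (coset g) = act g"
proof
  fix x assume g: "g \<in> carrier G"
  show "quot_act (coset g) x = act g x"
    using g bij_prop0[OF g]
    by (cases "x \<in> X") (auto simp: quot_act_coset quot_act_outside Bij_def extensional_def)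
qed

lemma quot_mult: "\<lbrakk>g \<in> carrier G; h \<in> carrier G\<rbrakk> \<Longrightarrow> coset g \<otimes>\<^bsub>quot\<^esub> coset h = coset (g \<otimes> h)"
  by (simp add: normal.rcos_sum[OF normal_act_kernel])

lemma quot_one: "\<one>\<^bsub>quot\<^esub> = coset \<one>"
  by (simp add: coset_mult_one act_kernel_subset)

text \<open>This makes the results on germs below available for both groupoids, through a second
  interpretation of the locale.\<close>

lemma self_similar_quot: "self_similar_action quot X quot_act quot_res"
proof -
  interpret Q: group quot by (rule normal.factorgroup_is_group[OF normal_act_kernel])
  show ?thesis
  proof (intro self_similar_action.intro group_action.intro self_similar_action_axioms.intro)
    show "group_hom quot (BijGroup X) quot_act"
    proof (intro group_hom.intro group_hom_axioms.intro Q.group_axioms group_BijGroup homI)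
      fix A assume "A \<in> carrier quot"
      then show "quot_act A \<in> carrier (BijGroup X)"
        by (auto simp: carrier_FactGroup quot_act_coset_eq BijGroup_def bij_prop0)
    next
      fix A B assume "A \<in> carrier quot" "B \<in> carrier quot"
      then obtain g h where "g \<in> carrier G" "h \<in> carrier G" "A = coset g" "B = coset h"
        by (auto simp: carrier_FactGroup)
      then show "quot_act (A \<otimes>\<^bsub>quot\<^esub> B) = quot_act A \<otimes>\<^bsub>BijGroup X\<^esub> quot_act B"
        using group_hom.hom_mult[OF group_hom]
        by (simp add: quot_mult quot_act_coset_eq del: mult_FactGroup)
    qed
    show "finite X" "2 \<le> card X" by (rule finite_alphabet card_alphabet)+
  next
    fix A x assume "A \<in> carrier quot" "x \<in> X"
    then show "quot_res A x \<in> carrier quot"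
      by (auto simp: carrier_FactGroup quot_res_coset res_closed)
  next
    fix A B x assume "A \<in> carrier quot" "B \<in> carrier quot" and x: "x \<in> X"
    then obtain g h where "g \<in> carrier G" "h \<in> carrier G" "A = coset g" "B = coset h"
      by (auto simp: carrier_FactGroup)
    then show "quot_res (A \<otimes>\<^bsub>quot\<^esub> B) x = quot_res A (quot_act B x) \<otimes>\<^bsub>quot\<^esub> quot_res B x"
      using x by (simp add: quot_mult quot_act_coset quot_res_coset res_mult act_closed res_closed
          del: mult_FactGroup)
  qed
qed

end


section \<open>Germs\<close>

context self_similar_action
begin

section \<open>Infinite words, cylinders and the action on infinite words\<close>

lemma in_inf_words_iff: "w \<in> topspace inf_words \<longleftrightarrow> (\<forall>n. w n \<in> X)"
  by (auto simp: inf_words_def PiE_iff)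

lemma prefix_closed: "w \<in> topspace inf_words \<Longrightarrow> w[i \<rightarrow> j] \<in> lists X"
  by (auto simp: in_inf_words_iff)

lemma mem_cylinder_iff:
  assumes "u \<in> lists X"
  shows "w \<in> cylinder u \<longleftrightarrow> w \<in> topspace inf_words \<and> prefix (length u) w = u"
proof
  assume "w \<in> cylinder u"
  then show "w \<in> topspace inf_words \<and> prefix (length u) w = u"
    using assms by (auto simp: cylinder_def) (auto simp: in_inf_words_iff conc_def)
next
  assume w: "w \<in> topspace inf_words \<and> prefix (length u) w = u"
  then have "w = u \<frown> suffix (length u) w"
    by (metis prefix_suffix)
  moreover have "suffix (length u) w \<in> topspace inf_words"
    using w by (auto simp: in_inf_words_iff)
  ultimately show "w \<in> cylinder u" by (auto simp: cylinder_def)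
qed

text \<open>Only the finitely many coordinates below \<open>length u\<close> are restricted, so a
  cylinder is a basic open set of the product.\<close>

lemma openin_cylinder:
  assumes "u \<in> lists X"
  shows "openin inf_words (cylinder u)"
proof -
  let ?A = "\<lambda>i. if i < length u then {u ! i} else X"
  have X: "u ! i \<in> X" if "i < length u" for i using assms that by auto
  have "prefix (length u) w = u \<longleftrightarrow> (\<forall>i<length u. w i = u ! i)" for w
    unfolding list_eq_iff_nth_eq[of _ u] by simp
  then have "w \<in> cylinder u \<longleftrightarrow> (\<forall>n. w n \<in> X) \<and> (\<forall>i<length u. w i = u ! i)" for w
    unfolding mem_cylinder_iff[OF assms] in_inf_words_iff by simp
  moreover have "(\<forall>n. w n \<in> X) \<and> (\<forall>i<length u. w i = u ! i) \<longleftrightarrow> w \<in> Pi\<^sub>E UNIV ?A" for w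
    using X by (auto simp: PiE_iff split: if_splits)
  ultimately have "cylinder u = Pi\<^sub>E UNIV ?A" by blast
  moreover have "openin inf_words (Pi\<^sub>E UNIV ?A)"
    unfolding inf_words_def
    by (rule product_topology_basis) (use X in \<open>auto intro: finite_subset[of _ "{..<length u}"]\<close>)
  ultimately show ?thesis by simp
qed

text \<open>The action is compatible with prolonging words, so the letters that
  \<open>act_inf\<close> reads off from ever longer prefixes fit together.\<close>

lemma prefix_act_inf: "prefix n (act_inf g w) = act_word g (prefix n w)"
proof (rule nth_equalityI)
  fix i assume "i < length (prefix n (act_inf g w))"
  then have i: "i < n" by simp
  then have "prefix n w = prefix (Suc i) w @ w[Suc i \<rightarrow> n]"
    using subsequence_append[of w "Suc i" "n - Suc i"] by simp
  then show "prefix n (act_inf g w) ! i = act_word g (prefix n w) ! i"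
    using i by (simp add: act_inf_def act_word_append nth_append)
qed simp

lemma act_inf_closed:
  assumes "g \<in> carrier G" "w \<in> topspace inf_words"
  shows "act_inf g w \<in> topspace inf_words"
proof -
  have "act_inf g w n \<in> X" for n
  proof -
    have "prefix (Suc n) (act_inf g w) ! n = act_inf g w n" by (subst subsequence_nth) auto
    moreover have "prefix (Suc n) (act_inf g w) \<in> lists X"
      unfolding prefix_act_inf using assms by (intro act_word_closed prefix_closed)
    ultimately show ?thesis by (metis in_listsD subsequence_length lessI diff_zero nth_mem)
  qed
  then show ?thesis by (simp add: in_inf_words_iff)
qed

section \<open>Germs as eventual equality of refined triples\<close>

lemma germ_pairs_iff:
  "(s, w) \<in> germ_pairs \<longleftrightarrow> w \<in> topspace inf_words \<and>
     (\<exists>p g q. s = Triple p g q \<and> p \<in> lists X \<and> g \<in> carrier G \<and> q \<in> lists X \<and> prefix (length q) w = q)"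
  by (auto simp: germ_pairs_def S_def mem_cylinder_iff in_lists_conv_set)

lemma germ_pairsE:
  assumes "(s, w) \<in> germ_pairs"
  obtains p g q where "s = Triple p g q" "p \<in> lists X" "g \<in> carrier G" "q \<in> lists X"
    "w \<in> topspace inf_words" "prefix (length q) w = q"
  using assms germ_pairs_iff by blast

text \<open>
  For words \<open>W\<close> extending \<open>q\<close> this is the product of \<open>(p, g, q)\<close> with the idempotent \<open>(W, 1, W)\<close>.
\<close>

fun refine :: "('x, 'g) triple \<Rightarrow> 'x list \<Rightarrow> ('x, 'g) triple" where
  "refine Zero W = Zero"
| "refine (Triple p g q) W =
     Triple (p @ act_word g (drop (length q) W)) (res_word g (drop (length q) W)) W"

text \<open>Meant for refinements of a triple \<open>s\<close> along \<open>w\<close>, where it is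
  eventually a prefix of the image word \<open>S_app s w\<close>. The value at \<open>Zero\<close>
  is a dummy.\<close>

primrec head :: "('x, 'g) triple \<Rightarrow> 'x list" where
  "head Zero = []"
| "head (Triple p g q) = p"

text \<open>Both \<open>q\<close> and \<open>u\<close> are prefixes of \<open>w\<close>, and the
  product prolongs the shorter one to the longer; hence the maximum.\<close>

lemma S_mult_idempotent:
  assumes "(Triple p g q, w) \<in> germ_pairs" "u \<in> lists X" "w \<in> cylinder u"
  shows "S_mult (Triple p g q) (Triple u \<one> u) =
    refine (Triple p g q) (prefix (max (length q) (length u)) w)"
proof (cases "length q \<le> length u")
  case True
  have "u = q @ w[length q \<rightarrow> length u]"
    using assms True subsequence_append[of w "length q" "length u - length q"]
    by (auto simp: germ_pairs_iff mem_cylinder_iff)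
  moreover have "prefix (length u) w = u" using assms by (simp add: mem_cylinder_iff)
  moreover have "res_word g (w[length q \<rightarrow> length u]) \<in> carrier G"
    using assms by (intro res_word_closed prefix_closed) (auto simp: germ_pairs_iff)
  ultimately show ?thesis using True by (auto simp: max_def Let_def)
next
  \<comment> \<open>The product is the triple itself, since \<open>\<one>\<close> fixes the surplus
    of \<open>q\<close> over \<open>u\<close>, and refining to \<open>q\<close> changes nothing
    either.\<close>
  case False
  have q: "q = u @ w[length u \<rightarrow> length q]"
    using assms False subsequence_append[of w "length u" "length q - length u"]
    by (auto simp: germ_pairs_iff mem_cylinder_iff)
  have "prefix (length q) w = q" using assms by (simp add: germ_pairs_iff)
  have "drop (length u) q \<in> lists X"
    using assms by (auto simp: germ_pairs_iff dest: in_set_dropD)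
  moreover have "\<nexists>r. u = q @ r" using False by auto
  moreover have "u @ drop (length u) q = q" using q by (metis append_eq_conv_conj)
  moreover have "\<exists>s. q = u @ s" using q by blast
  ultimately show ?thesis
    using False assms \<open>prefix (length q) w = q\<close>
    by (auto simp: Let_def act_word_one res_word_one germ_pairs_iff max_def)
qed

text \<open>Consequently, agreement of two triples at one common refinement persists at all longer
  ones.\<close>

lemma refine_refine:
  assumes "length q \<le> m" "m \<le> n"
  shows "refine (refine (Triple p g q) (prefix m w)) (prefix n w) =
    refine (Triple p g q) (prefix n w)"
proof -
  have "w[length q \<rightarrow> n] = w[length q \<rightarrow> m] @ w[m \<rightarrow> n]"
    using assms by (auto simp: subsequence_def simp flip: map_append)
      (metis le_add_diff_inverse upt_add_eq_append)
  then show ?thesis by (simp add: act_word_append res_word_append)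
qed

text \<open>With eventual equality in place of a chosen idempotent, transitivity and compatibility
  with products become arguments about filters.\<close>

lemma germ_rel_iff:
  "((s, w), (t, w')) \<in> germ_rel \<longleftrightarrow>
     (s, w) \<in> germ_pairs \<and> (t, w') \<in> germ_pairs \<and> w = w' \<and>
     (\<forall>\<^sub>F m in sequentially. refine s (prefix m w) = refine t (prefix m w))"
  (is "?L \<longleftrightarrow> ?R")
proof
  assume L: ?L
  then obtain u where u: "u \<in> lists X" "w \<in> cylinder u"
      "S_mult s (Triple u \<one> u) = S_mult t (Triple u \<one> u)"
    and [simp]: "w' = w" and gp: "(s, w) \<in> germ_pairs" "(t, w) \<in> germ_pairs"
    unfolding germ_rel_def by blast
  obtain p g q p' h q' where st: "s = Triple p g q" "t = Triple p' h q'"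
    using gp by (meson germ_pairsE)
  define M where "M = max (length q) (length u)"
  have "refine s (prefix M w) = refine t (prefix (max (length q') (length u)) w)"
    using u gp unfolding st M_def by (simp only: S_mult_idempotent)
  \<comment> \<open>The last component of a refinement is the prefix itself, so equal refinements
    have prefixes of equal length.\<close>
  moreover from this have "M = max (length q') (length u)"
    by (metis refine.simps(2) st triple.inject subsequence_length diff_zero)
  ultimately have eq: "refine s (prefix M w) = refine t (prefix M w)" and
    M: "length q \<le> M" "length q' \<le> M" by (auto simp: M_def)
  have "refine s (prefix n w) = refine t (prefix n w)" if "n \<ge> M" for n
    using refine_refine[OF M(1) that] refine_refine[OF M(2) that] eq st by metis
  then show ?R using gp by (auto simp: eventually_sequentially)
next
  assume R: ?R
  then have gp: "(s, w) \<in> germ_pairs" "(t, w) \<in> germ_pairs" and [simp]: "w' = w" by auto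
  obtain p g q p' h q' where st: "s = Triple p g q" "t = Triple p' h q'"
    using gp by (meson germ_pairsE)
  have "\<forall>\<^sub>F m in sequentially. m \<ge> max (length q) (length q') \<and>
      refine s (prefix m w) = refine t (prefix m w)"
    using R eventually_ge_at_top[of "max (length q) (length q')"] by (intro eventually_conj) auto
  then obtain m where m: "m \<ge> max (length q) (length q')"
      "refine s (prefix m w) = refine t (prefix m w)"
    using eventually_happens'[OF sequentially_bot] by blast
  have w: "w \<in> topspace inf_words" using gp by (simp add: germ_pairs_iff)
  then have u: "prefix m w \<in> lists X" "w \<in> cylinder (prefix m w)"
    using prefix_closed by (auto simp: mem_cylinder_iff)
  \<comment> \<open>The witness \<open>u\<close> is the prefix of length \<open>m\<close>; as it is
    at least as long as \<open>q\<close> and \<open>q'\<close>, the maxima in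
    \<open>S_mult_idempotent\<close> collapse to \<open>m\<close>.\<close>
  have "max (length q) m = m" "max (length q') m = m" using m by auto
  then have "S_mult s (Triple (prefix m w) \<one> (prefix m w)) =
      S_mult t (Triple (prefix m w) \<one> (prefix m w))"
    using S_mult_idempotent[OF gp(1)[unfolded st] u] S_mult_idempotent[OF gp(2)[unfolded st] u]
    by (simp only: st m(2)[unfolded st] subsequence_length diff_zero)
  with u gp show ?L by (auto simp: germ_rel_def)
qed

lemma equiv_germ_rel: "equiv germ_pairs germ_rel"
proof (rule equivI)
  show "germ_rel \<subseteq> germ_pairs \<times> germ_pairs" by (auto simp: germ_rel_iff)
  show "refl_on germ_pairs germ_rel" by (auto simp: refl_on_def germ_rel_iff)
  show "sym germ_rel" by (auto simp: sym_def germ_rel_iff elim: eventually_mono)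
  show "trans germ_rel" by (auto simp: trans_def germ_rel_iff elim: eventually_elim2)
qed

lemma germ_eq_iff:
  assumes "(s, w) \<in> germ_pairs" "(t, w') \<in> germ_pairs"
  shows "germ s w = germ t w' \<longleftrightarrow> w = w' \<and>
    (\<forall>\<^sub>F m in sequentially. refine s (prefix m w) = refine t (prefix m w))"
  using eq_equiv_class_iff[OF equiv_germ_rel assms] assms by (auto simp: germ_def germ_rel_iff)

section \<open>Image words and products of germs\<close>

lemma head_refine:
  assumes "(s, w) \<in> germ_pairs"
  shows "\<forall>\<^sub>F m in sequentially.
    head (refine s (prefix m w)) = prefix (length (head (refine s (prefix m w)))) (S_app s w)"
proof -
  obtain p g q where s: "s = Triple p g q" using assms by (meson germ_pairsE)
  show ?thesis
    using eventually_ge_at_top[of "length q"]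
    by eventually_elim
      (simp add: s prefix_act_inf subsequence_prefix_suffix)
qed

text \<open>Refining to length \<open>m\<close> gives a head of length at least
  \<open>m - length q\<close>. This allows eventual statements along the image word to be pulled
  back to \<open>w\<close>.\<close>

lemma filterlim_length_head_refine:
  assumes "(s, w) \<in> germ_pairs"
  shows "filterlim (\<lambda>m. length (head (refine s (prefix m w)))) sequentially sequentially"
proof -
  obtain p g q where s: "s = Triple p g q" using assms by (meson germ_pairsE)
  have "\<forall>m\<ge>Z + length q. Z \<le> length (head (refine s (prefix m w)))" for Z
    by (auto simp: s)
  then show ?thesis
    unfolding filterlim_at_top eventually_sequentially by blast
qed

lemma S_app_closed:
  assumes "(s, w) \<in> germ_pairs"
  shows "S_app s w \<in> topspace inf_words"
proof -
  obtain p g q where s: "s = Triple p g q" "p \<in> lists X" "g \<in> carrier G" "w \<in> topspace inf_words"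
    using assms by (meson germ_pairsE)
  then have "act_inf g (suffix (length q) w) \<in> topspace inf_words"
    by (intro act_inf_closed) (auto simp: in_inf_words_iff)
  with s show ?thesis by (auto simp: in_inf_words_iff conc_def)
qed

text \<open>Heads of refinements are prefixes of the image word and grow without bound, and
  representatives of one germ eventually have the same heads.\<close>

lemma S_app_germ:
  assumes gp: "(s, w) \<in> germ_pairs" "(t, w) \<in> germ_pairs" and eq: "germ s w = germ t w"
  shows "S_app s w = S_app t w"
proof
  fix i
  have "\<forall>\<^sub>F m in sequentially. Suc i \<le> length (head (refine s (prefix m w)))"
    using filterlim_length_head_refine[OF gp(1)] unfolding filterlim_at_top by blast
  moreover have "\<forall>\<^sub>F m in sequentially. refine s (prefix m w) = refine t (prefix m w)"
    using eq gp by (simp add: germ_eq_iff)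
  ultimately have "\<forall>\<^sub>F m in sequentially. S_app s w i = S_app t w i"
    using head_refine[OF gp(1)] head_refine[OF gp(2)]
    by eventually_elim (metis Suc_le_eq add_0 diff_zero subsequence_nth)
  then show "S_app s w i = S_app t w i" by simp
qed

text \<open>After refinement the two inner words coincide, so the product on the right merely
  multiplies the group elements. This exhibits the germ of a product as a function of the germs of
  its factors.\<close>

lemma S_mult_germ:
  assumes t: "(t, w) \<in> germ_pairs" and s: "(s, S_app t w) \<in> germ_pairs"
  shows "(S_mult s t, w) \<in> germ_pairs \<and> (\<forall>\<^sub>F m in sequentially.
    refine (S_mult s t) (prefix m w) =
      S_mult (refine s (head (refine t (prefix m w)))) (refine t (prefix m w)))"
proof -
  obtain p' h q' where t': "t = Triple p' h q'" "p' \<in> lists X" "h \<in> carrier G" "q' \<in> lists X"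
    "w \<in> topspace inf_words" "prefix (length q') w = q'" using t by (rule germ_pairsE)
  obtain p g q where s': "s = Triple p g q" "p \<in> lists X" "g \<in> carrier G" "q \<in> lists X"
    "prefix (length q) (S_app t w) = q" using s by (rule germ_pairsE)
  have seg: "w[i \<rightarrow> j] \<in> lists X" for i j using t'(5) by (rule prefix_closed)
  have app: "S_app t w = p' \<frown> act_inf h (suffix (length q') w)" by (simp add: t')
  show ?thesis
  proof (cases "\<exists>r. p' = q @ r")
    case True
    then obtain r where r: "p' = q @ r" by blast
    then have rX: "r \<in> lists X" using t' by simp
    have st: "S_mult s t = Triple (p @ act_word g r) (res_word g r \<otimes> h) q'"
      by (simp add: s' t' r)
    have "(S_mult s t, w) \<in> germ_pairs"
      unfolding st germ_pairs_iff using s' t' rX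
      by (simp add: act_word_closed res_word_closed del: in_lists_conv_set)
    moreover have "refine (S_mult s t) (prefix m w) =
        S_mult (refine s (head (refine t (prefix m w)))) (refine t (prefix m w))" for m
      unfolding st
      using s' t' rX seg
      by (simp add: r act_word_append res_word_append act_word_mult res_word_mult
          res_word_closed act_word_closed m_assoc del: in_lists_conv_set)
    ultimately show ?thesis by simp
  next
    case False
    \<comment> \<open>Both \<open>q\<close> and \<open>p'\<close> are prefixes of
      \<open>S_app t w\<close>, hence comparable, so the product cannot be
      \<open>Zero\<close>.\<close>
    have "length p' \<le> length q"
    proof (rule ccontr)
      assume "\<not> length p' \<le> length q"
      then have "q = take (length q) p'" using s'(5) unfolding app by simp
      then show False using False by (metis append_take_drop_id)
    qed
    define k where "k = length q - length p'"
    \<comment> \<open>This is the segment of \<open>w\<close> that \<open>h\<close> carries to the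
      surplus of \<open>q\<close> over \<open>p'\<close>; in \<open>S_mult\<close> it is recovered
      by applying \<open>inv h\<close>.\<close>
    define u where "u = w[length q' \<rightarrow> length q' + k]"
    have q: "q = p' @ act_word h u"
      using s'(5) \<open>length p' \<le> length q\<close> unfolding app
      by (simp add: prefix_act_inf subsequence_prefix_suffix k_def u_def)
    have uX: "u \<in> lists X" using seg by (simp add: u_def)
    have "act_word (inv h) (act_word h u) = u" using t' uX by (simp add: act_word_inv)
    moreover have "\<nexists>r. p' = q @ r" using False by blast
    ultimately have st: "S_mult s t = Triple p (g \<otimes> res_word h u) (q' @ u)"
      unfolding s' t' S_mult.simps by (simp add: q Let_def)
    have pre: "prefix (length (q' @ u)) w = q' @ u"
      using subsequence_append[of w "length q'" k] t' by (simp add: u_def)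
    have "(S_mult s t, w) \<in> germ_pairs"
      unfolding st germ_pairs_iff using s' t' uX pre
      by (simp add: act_word_closed res_word_closed del: in_lists_conv_set)
    moreover have "refine (S_mult s t) (prefix m w) =
        S_mult (refine s (head (refine t (prefix m w)))) (refine t (prefix m w))"
      if "m \<ge> length q' + k" for m
    proof -
      define v where "v = w[length q' + k \<rightarrow> m]"
      have "v \<in> lists X" using seg by (simp add: v_def)
      moreover have "prefix m w = q' @ u @ v"
        using that pre subsequence_append[of w "length q' + k" "m - (length q' + k)"]
        by (simp add: v_def u_def)
      ultimately show ?thesis
        unfolding st using s' t' uX
        by (simp add: q act_word_append res_word_append act_word_mult res_word_mult
            res_word_closed act_word_closed m_assoc del: in_lists_conv_set)
    qed
    ultimately show ?thesis by (auto simp: eventually_sequentially)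
  qed
qed

lemma germ_S_mult_cong:
  assumes t: "(t, w) \<in> germ_pairs" and s: "(s, S_app t w) \<in> germ_pairs"
    and t': "(t', w) \<in> germ_pairs" and s': "(s', S_app t' w) \<in> germ_pairs"
    and eqt: "germ t w = germ t' w" and eqs: "germ s (S_app t w) = germ s' (S_app t' w)"
  shows "germ (S_mult s t) w = germ (S_mult s' t') w"
proof -
  let ?n = "\<lambda>m. length (head (refine t (prefix m w)))"
  have [simp]: "S_app t' w = S_app t w" using S_app_germ[OF t t' eqt] by simp
  have "\<forall>\<^sub>F m in sequentially. refine s (prefix m (S_app t w)) = refine s' (prefix m (S_app t w))"
    using eqs s s' by (simp add: germ_eq_iff)
  \<comment> \<open>The eventual equality along the image word is reindexed by the head lengths,
    which tend to infinity.\<close>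
  then have "\<forall>\<^sub>F m in sequentially.
      refine s (prefix (?n m) (S_app t w)) = refine s' (prefix (?n m) (S_app t w))"
    by (rule eventually_compose_filterlim[OF _ filterlim_length_head_refine[OF t]])
  moreover have "\<forall>\<^sub>F m in sequentially. refine t (prefix m w) = refine t' (prefix m w)"
    using eqt t t' by (simp add: germ_eq_iff)
  ultimately have "\<forall>\<^sub>F m in sequentially.
      refine (S_mult s t) (prefix m w) = refine (S_mult s' t') (prefix m w)"
    using S_mult_germ[OF t s, THEN conjunct2] S_mult_germ[OF t' s', THEN conjunct2] head_refine[OF t]
    by eventually_elim simp
  then show ?thesis using S_mult_germ[OF t s] S_mult_germ[OF t' s'] by (simp add: germ_eq_iff)
qed

section \<open>The structure maps and the arrow space in terms of representatives\<close>

lemma germ_src_germ: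
  assumes "(s, w) \<in> germ_pairs"
  shows "germ_src (germ s w) = unit_germ w"
  unfolding germ_src_def using assms by (intro the_equality) (auto simp: germ_eq_iff)

text \<open>By \<open>S_app_germ\<close> the image point does not depend on the representative, so
  the description under \<open>THE\<close> is unique.\<close>

lemma germ_rng_germ:
  assumes "(s, w) \<in> germ_pairs"
  shows "germ_rng (germ s w) = unit_germ (S_app s w)"
  unfolding germ_rng_def
proof (rule the_equality)
  fix c assume "\<exists>(t, w')\<in>germ_pairs. germ s w = germ t w' \<and> c = unit_germ (S_app t w')"
  then obtain t w' where "(t, w') \<in> germ_pairs" "germ s w = germ t w'" "c = unit_germ (S_app t w')"
    by auto
  moreover from this have "w' = w" using assms by (simp add: germ_eq_iff)
  ultimately show "c = unit_germ (S_app s w)" using assms S_app_germ by metis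
qed (use assms in \<open>auto intro!: bexI[of _ "(s, w)"]\<close>)

text \<open>Uniqueness under \<open>THE\<close> is the content of
  \<open>germ_S_mult_cong\<close>.\<close>

lemma germ_comp_germ:
  assumes t: "(t, w) \<in> germ_pairs" and s: "(s, S_app t w) \<in> germ_pairs"
  shows "germ_comp (germ s (S_app t w)) (germ t w) = germ (S_mult s t) w"
  unfolding germ_comp_def
proof (rule the_equality)
  fix c assume "\<exists>s' t' w'. (s', S_app t' w') \<in> germ_pairs \<and> (t', w') \<in> germ_pairs \<and>
    germ s (S_app t w) = germ s' (S_app t' w') \<and> germ t w = germ t' w' \<and> c = germ (S_mult s' t') w'"
  then obtain s' t' w' where *: "(s', S_app t' w') \<in> germ_pairs" "(t', w') \<in> germ_pairs"
    "germ s (S_app t w) = germ s' (S_app t' w')" "germ t w = germ t' w'" "c = germ (S_mult s' t') w'"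
    by blast
  moreover from * have "w' = w" using t by (simp add: germ_eq_iff)
  ultimately show "c = germ (S_mult s t) w" using t s germ_S_mult_cong by metis
qed (rule exI[of _ s], rule exI[of _ t], rule exI[of _ w], use assms in simp)

lemma unit_germ_pair: "w \<in> topspace inf_words \<Longrightarrow> (Triple [] \<one> [], w) \<in> germ_pairs"
  by (simp add: germ_pairs_iff)

lemma unit_germ_eq_iff:
  "\<lbrakk>w \<in> topspace inf_words; w' \<in> topspace inf_words\<rbrakk> \<Longrightarrow> unit_germ w = unit_germ w' \<longleftrightarrow> w = w'"
  unfolding unit_germ_def by (auto simp: germ_eq_iff unit_germ_pair)

text \<open>Domains of nonzero triples are open cylinders, so each germ lies in the generating set
  taken over the whole domain.\<close>

lemma topspace_germ_topology: "topspace germ_topology = {germ s w | s w. (s, w) \<in> germ_pairs}"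
proof -
  have "germ s w \<in> \<Union> {germ s ` U | s U. s \<in> S \<and> openin inf_words U \<and> U \<subseteq> S_dom s}"
    if "(s, w) \<in> germ_pairs" for s w
  proof -
    have "openin inf_words (S_dom s)" using that by (auto elim!: germ_pairsE intro: openin_cylinder)
    then show ?thesis using that by (auto simp: germ_pairs_def)
  qed
  then show ?thesis
    unfolding germ_topology_def topology_generated_by_topspace by (fastforce simp: germ_pairs_def)
qed

end

text \<open>Continuity may be tested on generating sets. Injectivity makes \<open>V\<close> the full
  preimage of its image, so these sets correspond in both directions.\<close>

lemma homeomorphic_map_topology_generated_by:
  assumes inj: "inj_on f (\<Union>\<B>)" and img: "(`) f ` \<B> = \<C>"
  shows "homeomorphic_map (topology_generated_by \<B>) (topology_generated_by \<C>) f"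
proof -
  define T where "T = \<Union>\<B>"
  let ?g = "inv_into T f"
  have top: "topspace (topology_generated_by \<B>) = T" "topspace (topology_generated_by \<C>) = f ` T"
    unfolding T_def topology_generated_by_topspace using img by blast+
  have gf: "?g (f x) = x" if "x \<in> T" for x using inj that unfolding T_def by (rule inv_into_f_f)
  have vim: "f -` (f ` V) \<inter> T = V" "?g -` V \<inter> f ` T = f ` V" if "V \<in> \<B>" for V
  proof -
    have "V \<subseteq> T" using that by (auto simp: T_def)
    then show "f -` (f ` V) \<inter> T = V" using gf by (auto simp: subset_iff) metis
    show "?g -` V \<inter> f ` T = f ` V" using \<open>V \<subseteq> T\<close> gf by (auto simp: subset_iff)
  qed
  have "continuous_map (topology_generated_by \<B>) (topology_generated_by \<C>) f"
  proof (rule continuous_on_generated_topo)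
    fix U assume "U \<in> \<C>"
    then obtain V where "V \<in> \<B>" "U = f ` V" using img by blast
    then show "openin (topology_generated_by \<B>) (f -` U \<inter> topspace (topology_generated_by \<B>))"
      unfolding top by (simp add: vim topology_generated_by_Basis)
  next
    show "f ` topspace (topology_generated_by \<B>) \<subseteq> \<Union>\<C>"
      unfolding top(1) using top(2) by (simp add: topology_generated_by_topspace)
  qed
  moreover have "continuous_map (topology_generated_by \<C>) (topology_generated_by \<B>) ?g"
  proof (rule continuous_on_generated_topo)
    fix V assume "V \<in> \<B>"
    moreover from this have "f ` V \<in> \<C>" using img by blast
    ultimately show "openin (topology_generated_by \<C>)
        (?g -` V \<inter> topspace (topology_generated_by \<C>))"
      unfolding top by (simp add: vim topology_generated_by_Basis)
  next
    have "?g ` f ` T \<subseteq> T" using gf by (simp add: image_subset_iff)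
    then show "?g ` topspace (topology_generated_by \<C>) \<subseteq> \<Union>\<B>" unfolding top T_def .
  qed
  ultimately show ?thesis
    unfolding homeomorphic_map_maps homeomorphic_maps_def top using gf by auto
qed


section \<open>The isomorphism\<close>

context self_similar_action
begin

text \<open>After the first \<open>n\<close> letters the restriction is \<open>\<one>\<close>, which
  acts trivially on all further letters.\<close>

lemma tight_kernel_level_long:
  assumes k: "k \<in> tight_kernel_level n" and w: "w \<in> lists X" "length w \<ge> n"
  shows "act_word k w = w \<and> res_word k w = \<one>"
proof -
  have "take n w \<in> lists X" "drop n w \<in> lists X" "length (take n w) = n"
    using w by (auto dest: in_set_takeD in_set_dropD)
  then show ?thesis
    using k act_word_append[of k "take n w" "drop n w"] res_word_append[of k "take n w" "drop n w"]
    by (auto simp: tight_kernel_level_def act_word_one res_word_one simp del: in_lists_conv_set)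
qed

section \<open>The quotient map on words, triples and their products\<close>

interpretation Q: self_similar_action quot X quot_act quot_res
  by (rule self_similar_quot)

lemma quot_act_word: "\<lbrakk>g \<in> carrier G; w \<in> lists X\<rbrakk> \<Longrightarrow> Q.act_word (coset g) w = act_word g w"
  by (induction w arbitrary: g) (auto simp: quot_act_coset quot_res_coset res_closed)

lemma quot_res_word:
  "\<lbrakk>g \<in> carrier G; w \<in> lists X\<rbrakk> \<Longrightarrow> Q.res_word (coset g) w = coset (res_word g w)"
  by (induction w arbitrary: g) (auto simp: quot_res_coset res_closed)

lemma coset_closed: "g \<in> carrier G \<Longrightarrow> coset g \<in> carrier quot"
  by (auto simp: carrier_FactGroup)

lemma coset_inv:
  assumes "g \<in> carrier G"
  shows "inv\<^bsub>quot\<^esub> (coset g) = coset (inv g)"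
proof -
  have "coset (inv g) \<otimes>\<^bsub>quot\<^esub> coset g = \<one>\<^bsub>quot\<^esub>"
    using assms by (simp add: quot_mult quot_one del: mult_FactGroup one_FactGroup)
  then show ?thesis using assms by (intro Q.inv_equality coset_closed) auto
qed

abbreviation quot_triple :: "('x, 'g) triple \<Rightarrow> ('x, 'g set) triple" where
  "quot_triple \<equiv> map_triple id coset"

lemma quot_triple_image_S: "quot_triple ` S = Q.S"
  unfolding S_def Q.S_def by (force simp: carrier_FactGroup image_iff)

lemma quot_S_dom: "Q.S_dom (quot_triple s) = S_dom s"
  by (cases s) auto

lemma quot_germ_pairs_iff: "(s', w) \<in> Q.germ_pairs \<longleftrightarrow> (\<exists>s. s' = quot_triple s \<and> (s, w) \<in> germ_pairs)"
  unfolding germ_pairs_def Q.germ_pairs_def using quot_triple_image_S quot_S_dom by fastforce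

lemma quot_refine:
  assumes "(s, w) \<in> germ_pairs"
  shows "Q.refine (quot_triple s) (prefix m w) = quot_triple (refine s (prefix m w))"
  using assms by (auto elim!: germ_pairsE simp: quot_act_word quot_res_word prefix_closed)

lemma quot_S_app:
  assumes "(s, w) \<in> germ_pairs"
  shows "Q.S_app (quot_triple s) w = S_app s w"
proof -
  obtain p g q where s: "s = Triple p g q" "g \<in> carrier G" "w \<in> topspace inf_words"
    using assms by (meson germ_pairsE)
  then have "suffix (length q) w \<in> topspace inf_words" by (simp add: in_inf_words_iff)
  then have "Q.act_word (coset g) (prefix n (suffix (length q) w)) =
      act_word g (prefix n (suffix (length q) w))" for n
    using s(2) by (intro quot_act_word prefix_closed)
  then show ?thesis by (simp only: s(1) triple.map id_apply list.map_id Q.S_app.simps S_app.simps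
      Q.act_inf_def act_inf_def)
qed

text \<open>The case distinction in \<open>S_mult\<close> inspects words only, and
  \<open>quot_triple\<close> leaves these unchanged; the group components follow from coset
  multiplication and \<open>coset_inv\<close>.\<close>

lemma quot_S_mult:
  assumes "s \<in> S" "t \<in> S"
  shows "Q.S_mult (quot_triple s) (quot_triple t) = quot_triple (S_mult s t)"
proof (cases "s = Zero \<or> t = Zero")
  case True
  then show ?thesis by (cases s; cases t) auto
next
  case False
  then obtain p g q p' h q' where s: "s = Triple p g q" "g \<in> carrier G" "q \<in> lists X"
    and t: "t = Triple p' h q'" "h \<in> carrier G" "p' \<in> lists X"
    using assms unfolding S_def by blast
  have "drop n p' \<in> lists X" "drop n q \<in> lists X" for n
    using s t by (auto dest: in_set_dropD)
  then show ?thesis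
    using s(2) t(2)
    by (simp add: s(1) t(1) Let_def quot_act_word quot_res_word quot_mult coset_inv res_word_closed
        act_word_closed del: mult_FactGroup in_lists_conv_set)
qed

text \<open>One direction makes the map on germs well defined, the other makes it injective. For
  injectivity, loose faithfulness turns equality modulo the kernel into equality at longer
  prefixes.\<close>

lemma quot_germ_eq_iff:
  assumes lf: loosely_faithful and s: "(s, w) \<in> germ_pairs" and t: "(t, w') \<in> germ_pairs"
  shows "Q.germ (quot_triple s) w = Q.germ (quot_triple t) w' \<longleftrightarrow> germ s w = germ t w'"
proof (cases "w' = w")
  case [simp]: True
  have gp: "(quot_triple s, w) \<in> Q.germ_pairs" "(quot_triple t, w) \<in> Q.germ_pairs"
    using s t quot_germ_pairs_iff by auto
  have t: "(t, w) \<in> germ_pairs" using t by simp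
  have "(\<forall>\<^sub>F m in sequentially. refine s (prefix m w) = refine t (prefix m w))"
    if ev: "\<forall>\<^sub>F m in sequentially.
      quot_triple (refine s (prefix m w)) = quot_triple (refine t (prefix m w))"
  proof -
    obtain p g q where s': "s = Triple p g q" "g \<in> carrier G" "w \<in> topspace inf_words"
      using s by (meson germ_pairsE)
    obtain p' h q' where t': "t = Triple p' h q'" "h \<in> carrier G"
      using t by (meson germ_pairsE)
    \<comment> \<open>Once \<open>m\<close> exceeds both lengths, \<open>refine_refine\<close> can
      carry the comparison from \<open>m\<close> to every longer prefix.\<close>
    have "\<forall>\<^sub>F m in sequentially. m \<ge> max (length q) (length q') \<and>
        quot_triple (refine s (prefix m w)) = quot_triple (refine t (prefix m w))"
      using ev eventually_ge_at_top[of "max (length q) (length q')"] by (intro eventually_conj) auto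
    then obtain m where m: "m \<ge> length q" "m \<ge> length q'"
        "quot_triple (refine s (prefix m w)) = quot_triple (refine t (prefix m w))"
      using eventually_happens'[OF sequentially_bot] by fastforce
    define a b where "a = res_word g (w[length q \<rightarrow> m])" and "b = res_word h (w[length q' \<rightarrow> m])"
    have seg: "w[i \<rightarrow> j] \<in> lists X" for i j using s'(3) by (rule prefix_closed)
    have ab: "a \<in> carrier G" "b \<in> carrier G"
      unfolding a_def b_def using s' t' seg by (auto intro: res_word_closed)
    obtain z where ref: "refine s (prefix m w) = Triple z a (prefix m w)"
        "refine t (prefix m w) = Triple z b (prefix m w)" and "coset a = coset b"
      using m(3) unfolding s' t' a_def b_def by simp
    then have "a \<otimes> inv b \<in> tight_kernel"
      using ab lf by (simp add: coset_eq_iff loosely_faithful_def)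
    then obtain n where n: "a \<otimes> inv b \<in> tight_kernel_level n" by (auto simp: tight_kernel_def)
    have k: "a \<otimes> inv b \<in> carrier G" using ab by simp
    \<comment> \<open>The left factor lies in level \<open>n\<close> of the tight kernel. On a
      segment of length at least \<open>n\<close> it fixes the image under \<open>b\<close> and
      restricts to \<open>\<one>\<close> there, so \<open>a\<close> and \<open>b\<close> have the
      same action and restriction on that segment.\<close>
    have a: "a = (a \<otimes> inv b) \<otimes> b" using ab by (simp add: m_assoc)
    have "refine s (prefix m' w) = refine t (prefix m' w)" if "m' \<ge> m + n" for m'
    proof -
      let ?u = "w[m \<rightarrow> m']"
      have "act_word (a \<otimes> inv b) (act_word b ?u) = act_word b ?u \<and>
          res_word (a \<otimes> inv b) (act_word b ?u) = \<one>"
        using that ab seg by (intro tight_kernel_level_long[OF n] act_word_closed) auto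
      then have "act_word a ?u = act_word b ?u \<and> res_word a ?u = res_word b ?u"
        using act_word_mult[OF k ab(2) seg] res_word_mult[OF k ab(2) seg] a seg ab
        by (simp add: res_word_closed)
      then have "refine (Triple z a (prefix m w)) (prefix m' w) =
          refine (Triple z b (prefix m w)) (prefix m' w)" by simp
      moreover have "m \<le> m'" using that by simp
      ultimately show ?thesis
        using refine_refine[OF m(1)] refine_refine[OF m(2)] ref unfolding s' t' by metis
    qed
    then show ?thesis by (auto simp: eventually_sequentially)
  qed
  then show ?thesis
    using s t gp
    by (auto simp: germ_eq_iff Q.germ_eq_iff quot_refine elim: eventually_mono)
next
  case False
  moreover have "(quot_triple s, w) \<in> Q.germ_pairs" "(quot_triple t, w') \<in> Q.germ_pairs"
    using s t quot_germ_pairs_iff by auto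
  ultimately show ?thesis using s t by (simp add: germ_eq_iff Q.germ_eq_iff)
qed

text \<open>A germ is a class of representatives, and \<open>the_elem\<close> extracts the value
  they share, as \<open>quot_germ_germ\<close> confirms.\<close>

definition quot_germ ::
    "(('x, 'g) triple \<times> 'x word) set \<Rightarrow> (('x, 'g set) triple \<times> 'x word) set" where
  "quot_germ a = the_elem ((\<lambda>(s, w). Q.germ (quot_triple s) w) ` a)"

lemma quot_germ_germ:
  assumes lf: loosely_faithful and s: "(s, w) \<in> germ_pairs"
  shows "quot_germ (germ s w) = Q.germ (quot_triple s) w"
proof -
  have eq: "Q.germ (quot_triple t) w' = Q.germ (quot_triple s) w" if "(t, w') \<in> germ s w" for t w'
  proof -
    have *: "((s, w), (t, w')) \<in> germ_rel" using that by (simp add: germ_def)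
    then have "(t, w') \<in> germ_pairs" by (simp add: germ_rel_iff)
    moreover have "germ t w' = germ s w"
      unfolding germ_def using equiv_class_eq[OF equiv_germ_rel *] by simp
    ultimately show ?thesis using quot_germ_eq_iff[OF lf _ s] by blast
  qed
  have "(s, w) \<in> germ s w"
    unfolding germ_def using equiv_class_self[OF equiv_germ_rel s] .
  then have "(\<lambda>_. Q.germ (quot_triple s) w) ` germ s w = {Q.germ (quot_triple s) w}"
    by (rule image_constant)
  moreover have "(\<lambda>(s, w). Q.germ (quot_triple s) w) ` germ s w =
      (\<lambda>_. Q.germ (quot_triple s) w) ` germ s w"
    by (intro image_cong refl) (simp only: case_prod_beta, rule eq, simp only: prod.collapse)
  ultimately show ?thesis by (simp add: quot_germ_def)
qed

lemma quot_germ_unit_germ: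
  assumes lf: loosely_faithful and "w \<in> topspace inf_words"
  shows "quot_germ (unit_germ w) = Q.unit_germ w"
  using assms quot_one unfolding unit_germ_def Q.unit_germ_def
  by (simp add: quot_germ_germ unit_germ_pair del: one_FactGroup)

text \<open>The germs of \<open>s\<close> over \<open>U\<close> are mapped onto the germs of
  \<open>quot_triple s\<close> over the same \<open>U\<close>. Since \<open>quot_triple\<close> maps
  \<open>S\<close> onto \<open>Q.S\<close> and preserves domains, the generating families
  correspond.\<close>

lemma homeomorphic_map_quot_germ:
  assumes lf: loosely_faithful
  shows "homeomorphic_map germ_topology Q.germ_topology quot_germ"
proof -
  let ?B = "{germ s ` U | s U. s \<in> S \<and> openin inf_words U \<and> U \<subseteq> S_dom s}"
  have "inj_on quot_germ (topspace germ_topology)"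
    by (auto simp: inj_on_def topspace_germ_topology quot_germ_germ[OF lf] quot_germ_eq_iff[OF lf])
  then have "inj_on quot_germ (\<Union>?B)"
    unfolding germ_topology_def topology_generated_by_topspace .
  moreover have img: "quot_germ ` germ s ` U = Q.germ (quot_triple s) ` U"
    if "s \<in> S" "U \<subseteq> S_dom s" for s U
    using that unfolding image_image
    by (intro image_cong refl quot_germ_germ[OF lf]) (auto simp: germ_pairs_def)
  have "(`) quot_germ ` ?B = {Q.germ s ` U | s U. s \<in> Q.S \<and> openin inf_words U \<and> U \<subseteq> Q.S_dom s}"
  proof (intro subset_antisym subsetI)
    fix A assume "A \<in> (`) quot_germ ` ?B"
    then obtain s U where *: "A = quot_germ ` germ s ` U" "s \<in> S" "openin inf_words U" "U \<subseteq> S_dom s"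
      by blast
    then have "A = Q.germ (quot_triple s) ` U" "quot_triple s \<in> Q.S" "U \<subseteq> Q.S_dom (quot_triple s)"
      using img quot_triple_image_S quot_S_dom by auto
    with * show "A \<in> {Q.germ s ` U | s U. s \<in> Q.S \<and> openin inf_words U \<and> U \<subseteq> Q.S_dom s}" by blast
  next
    fix A assume "A \<in> {Q.germ s ` U | s U. s \<in> Q.S \<and> openin inf_words U \<and> U \<subseteq> Q.S_dom s}"
    then obtain s U where *: "A = Q.germ (quot_triple s) ` U" "s \<in> S" "openin inf_words U"
        "U \<subseteq> Q.S_dom (quot_triple s)"
      unfolding quot_triple_image_S[symmetric] by blast
    then have "A = quot_germ ` germ s ` U" "U \<subseteq> S_dom s" using img quot_S_dom by auto
    with * show "A \<in> (`) quot_germ ` ?B" by blast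
  qed
  ultimately show ?thesis
    unfolding germ_topology_def Q.germ_topology_def by (rule homeomorphic_map_topology_generated_by)
qed

lemma top_groupoid_iso_quot_germ:
  assumes lf: loosely_faithful
  shows "top_groupoid_iso germ_groupoid Q.germ_groupoid quot_germ"
  unfolding top_groupoid_iso_def germ_groupoid_def Q.germ_groupoid_def top_groupoid.simps
proof (intro conjI ballI impI homeomorphic_map_quot_germ[OF lf])
  fix a assume "a \<in> topspace germ_topology"
  then obtain s w where a: "a = germ s w" and s: "(s, w) \<in> germ_pairs"
    by (auto simp: topspace_germ_topology)
  have w: "w \<in> topspace inf_words" using s by (simp add: germ_pairs_iff)
  have s': "(quot_triple s, w) \<in> Q.germ_pairs" using s quot_germ_pairs_iff by blast
  show "quot_germ (germ_src a) = Q.germ_src (quot_germ a)"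
    using s s' w unfolding a
    by (simp add: germ_src_germ Q.germ_src_germ quot_germ_germ[OF lf] quot_germ_unit_germ[OF lf])
  show "quot_germ (germ_rng a) = Q.germ_rng (quot_germ a)"
    using s s' S_app_closed[OF s] unfolding a
    by (simp add: germ_rng_germ Q.germ_rng_germ quot_germ_germ[OF lf] quot_germ_unit_germ[OF lf]
        quot_S_app)
next
  fix a b
  assume "a \<in> topspace germ_topology" "b \<in> topspace germ_topology" and eq: "germ_src a = germ_rng b"
  then obtain s y t w where a: "a = germ s y" and s: "(s, y) \<in> germ_pairs"
    and b: "b = germ t w" and t: "(t, w) \<in> germ_pairs"
    by (auto simp: topspace_germ_topology)
  have "y \<in> topspace inf_words" using s by (simp add: germ_pairs_iff)
  \<comment> \<open>Composability equates two unit germs and therefore their base points, which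
    brings the pair into the form required by \<open>germ_comp_germ\<close>.\<close>
  then have y: "y = S_app t w"
    using eq s t S_app_closed[OF t]
    by (simp add: a b germ_src_germ germ_rng_germ unit_germ_eq_iff)
  note s = s[unfolded y]
  have t': "(quot_triple t, w) \<in> Q.germ_pairs" using t quot_germ_pairs_iff by blast
  have s': "(quot_triple s, Q.S_app (quot_triple t) w) \<in> Q.germ_pairs"
    using s quot_germ_pairs_iff unfolding quot_S_app[OF t] by blast
  have "s \<in> S" "t \<in> S" using s t by (auto simp: germ_pairs_def)
  then have "quot_germ (germ_comp a b) = Q.germ (Q.S_mult (quot_triple s) (quot_triple t)) w"
    using S_mult_germ[OF t s] unfolding a b y
    by (simp add: germ_comp_germ[OF t s] quot_germ_germ[OF lf] quot_S_mult)
  also have "\<dots> = Q.germ_comp (quot_germ a) (quot_germ b)"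
    using Q.germ_comp_germ[OF t' s'] s t unfolding a b y
    by (simp add: quot_germ_germ[OF lf] quot_S_app)
  finally show "quot_germ (germ_comp a b) = Q.germ_comp (quot_germ a) (quot_germ b)" .
qed

end

theorem theoremF:
  fixes G :: "('g, 'm) monoid_scheme"
    and X :: "'x set"
    and act :: "'g \<Rightarrow> 'x \<Rightarrow> 'x"
    and res :: "'g \<Rightarrow> 'x \<Rightarrow> 'g"
  assumes "self_similar_action G X act res"
  shows "(self_similar_data.loosely_faithful G X act res \<longrightarrow>
            isomorphic_top_groupoids
              (self_similar_data.germ_groupoid G X act res)
              (self_similar_data.germ_groupoid
                (G Mod self_similar_data.act_kernel G X act res) X
                (self_similar_data.quot_act act)
                (self_similar_data.quot_res G X act res)))
       \<and> (self_similar_data.contracting G X res \<longrightarrow>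
            (\<forall>g\<in>self_similar_data.nucleus G X res.
               g \<noteq> \<one>\<^bsub>G\<^esub> \<longrightarrow> (\<exists>w\<in>lists X. self_similar_data.act_word act res g w \<noteq> w)) \<longrightarrow>
            self_similar_data.loosely_faithful G X act res)"
proof -
  interpret self_similar_action G X act res by (rule assms)
  show ?thesis
    unfolding isomorphic_top_groupoids_def
    using top_groupoid_iso_quot_germ contracting_imp_loosely_faithful by blast
qed

end
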